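(* Let $S\subseteq\mathbb{R}^n$ be a star-shaped body with $\eta(S)>0$, let $\mu_S$ be the centroid of $S$, and let $M_S=\mathbb{E}_S[\|X-\mu_S\|^2]$ where $X$ is uniformly distributed on $S$. Then for any measurable partition $(S_1,S_3,S_2)$ of $S$, either \[ \mathrm{vol}(S_3)\ge \frac{\eta(S)}{4}\,\mathrm{vol}(S) \] or \[ \mathrm{vol}(S_3)\ge \frac{\eta(S)^{3/2}}{16\sqrt{M_S}}\, d(S_1,S_2)\,\min\{\mathrm{vol}(S_1),\mathrm{vol}(S_2)\}, \] where $d(S_1,S_2)=\inf\{\|x-y\|:x\in S_1,y\in S_2\}$.
   Context: A compact body is a compact set $S\subseteq\mathbb{R}^n$ with nonempty interior such that $S$ equals the closure of its interior. The kernel of $S$ is $K_S=\{x\in S:\ [x,y]\subseteq S \text{ for all } y\in S\}$. $S$ is star-shaped if $K_S\neq\emptyset$; a star-shaped body is a compact body that is star-shaped. $\eta(S)=\mathrm{vol}(K_S)/\mathrm{vol}(S)$. A measurable partition $(S_1,S_3,S_2)$ of $S$ means measurable, pairwise disjoint sets with union $S$. *)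

theory Defs
  imports "HOL-Analysis.Analysis"
begin

definition compact_body :: "'a::euclidean_space set \<Rightarrow> bool" where
  "compact_body S \<longleftrightarrow> compact S \<and> interior S \<noteq> {} \<and> closure (interior S) = S"

definition kernel :: "'a::euclidean_space set \<Rightarrow> 'a set" where
  "kernel S = {x \<in> S. \<forall>y \<in> S. closed_segment x y \<subseteq> S}"

definition star_shaped :: "'a::euclidean_space set \<Rightarrow> bool" where
  "star_shaped S \<longleftrightarrow> kernel S \<noteq> {}"

definition star_shaped_body :: "'a::euclidean_space set \<Rightarrow> bool" where
  "star_shaped_body S \<longleftrightarrow> compact_body S \<and> star_shaped S"

definition vol :: "'a::euclidean_space set \<Rightarrow> real" where
  "vol S = measure lebesgue S"

definition eta :: "'a::euclidean_space set \<Rightarrow> real" where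
  "eta S = vol (kernel S) / vol S"

definition centroid :: "'a::euclidean_space set \<Rightarrow> 'a" where
  "centroid S = (1 / vol S) *\<^sub>R integral S (\<lambda>x. x)"

definition second_moment :: "'a::euclidean_space set \<Rightarrow> real" where
  "second_moment S = integral S (\<lambda>x. (norm (x - centroid S))\<^sup>2) / vol S"

definition set_dist :: "'a::euclidean_space set \<Rightarrow> 'a set \<Rightarrow> real" where
  "set_dist A B = Inf {norm (x - y) | x y. x \<in> A \<and> y \<in> B}"

end

theory Submission
  imports Defs "HOL-Probability.Weak_Convergence" "HOL-Probability.Giry_Monad"
begin

text \<open>
  The key tool is a version of the Prekopa--Leindler inequality for a whole family of interpolation
  times. Let \<open>\<sigma>\<close> be a measure on \<open>[0,1]\<close>. If every segment from \<open>x \<in> X\<close> to \<open>y \<in> Y\<close> spends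
  \<open>\<sigma>\<close>-time at least \<open>\<theta>\<close> in \<open>C\<close>, then
  \<open>\<theta> \<le> vol C * \<integral> (vol X)\<^bsup>s-1\<^esup> (vol Y)\<^bsup>-s\<^esup> d\<sigma>(s)\<close>.
  In one dimension one couples the two densities by their quantile functions; the inequality
  tensorises because the weights are geometric means.

  Let \<open>R = sqrt (M / \<eta>)\<close>. By Chebyshev three quarters of the kernel lie within distance \<open>2 R\<close> of the
  centroid, so if \<open>vol S3 < \<eta> vol S / 4\<close>, then \<open>S1\<close> or \<open>S2\<close>, say \<open>S1\<close>, contains a set \<open>X\<close> of
  such kernel points of volume at least \<open>\<eta> vol S / 4\<close>. Segments from \<open>X\<close> to the part \<open>Y\<close> of \<open>S2\<close>
  within distance \<open>L\<close> of the centroid stay in \<open>S\<close> and hence spend time at least \<open>d / (2 R + L)\<close>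
  in \<open>S3\<close>. The tool with Lebesgue measure bounds \<open>vol S3\<close> from below by this time multiplied by the
  logarithmic mean of \<open>vol X\<close> and \<open>vol Y\<close>. The radius \<open>L = 6 R\<close> suffices unless \<open>S2\<close> is very small;
  then \<open>L\<close> is of order \<open>R ln (\<eta> vol S / vol S2)\<close>, which the logarithmic mean compensates.
\<close>

section \<open>The interpolation inequality\<close>

text \<open>A nonempty connected set of finite length lies in the closed interval from its
  \<open>Inf\<close> to its \<open>Sup\<close>, which is no longer than the set itself, so the bound
  on closed intervals applies.\<close>

lemma emeasure_connected_le_lborel:
  fixes N :: "real measure"
  assumes sets: "sets N = sets borel"
    and Icc: "\<And>a b. a \<le> b \<Longrightarrow> emeasure N {a..b} \<le> ennreal (b - a)"
    and C: "connected C" "C \<in> sets borel"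
  shows "emeasure N C \<le> emeasure lborel C"
proof (cases "emeasure lborel C = \<infinity> \<or> C = {}")
  case False
  then obtain m where m: "emeasure lborel C = ennreal m" "0 \<le> m"
    by (cases "emeasure lborel C") auto
  have width: "y - x \<le> m" if "x \<in> C" "y \<in> C" for x y
  proof (cases "x \<le> y")
    case True
    have "{x..y} \<subseteq> C"
      using C(1) that by (meson connected_contains_Icc)
    then have "emeasure lborel {x..y} \<le> emeasure lborel C"
      using C by (intro emeasure_mono) auto
    then show ?thesis
      using True m by simp
  qed (use m in auto)
  have bdd: "bdd_below C" "bdd_above C"
  proof -
    obtain z where z: "z \<in> C"
      using False by auto
    show "bdd_below C"
      using width[OF _ z] by (intro bdd_belowI[of _ "z - m"]) (auto simp: algebra_simps)
    show "bdd_above C"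
      using width[OF z] by (intro bdd_aboveI[of _ "z + m"]) (auto simp: algebra_simps)
  qed
  have "Sup C \<le> Inf C + m"
  proof (rule cSup_least)
    fix y assume y: "y \<in> C"
    have "y - m \<le> Inf C"
      using False width[OF _ y] by (intro cInf_greatest) (auto simp: algebra_simps)
    then show "y \<le> Inf C + m" by simp
  qed (use False in auto)
  moreover have "Inf C \<le> Sup C"
    using False bdd by (meson cInf_le_cSup)
  moreover have "C \<subseteq> {Inf C..Sup C}"
    using bdd by (auto intro: cInf_lower cSup_upper)
  then have "emeasure N C \<le> emeasure N {Inf C..Sup C}"
    using sets by (intro emeasure_mono) auto
  ultimately show ?thesis
    using Icc[of "Inf C" "Sup C"] m by (auto intro: order_trans ennreal_leI)
qed auto

text \<open>Open sets are countable disjoint unions of their components, which are intervals; outer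
  regularity of Lebesgue measure then reaches all Borel sets.\<close>

lemma le_lborel_if_Icc_le:
  fixes N :: "real measure"
  assumes sets: "sets N = sets borel"
    and Icc: "\<And>a b. a \<le> b \<Longrightarrow> emeasure N {a..b} \<le> ennreal (b - a)"
  shows "N \<le> lborel"
proof -
  have opn: "emeasure N U \<le> emeasure lborel U" if U: "open U" for U
  proof -
    have op: "open C" if "C \<in> components U" for C
      using that U by (simp add: open_components)
    have disj: "disjoint (components U)"
      by (simp add: pairwise_disjoint_components disjoint_def components_nonoverlap)
    have cnt: "countable (components U)"
      using countable_disjoint_open_subsets[OF op disj] by auto
    have dj: "disjoint_family_on (\<lambda>C. C) (components U)"
      using disj by (auto simp: disjoint_family_on_def disjoint_def)
    have "emeasure N U = emeasure N (\<Union>C\<in>components U. C)"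
      by simp
    also have "\<dots> = (\<integral>\<^sup>+C. emeasure N C \<partial>count_space (components U))"
      using op sets by (intro emeasure_UN_countable cnt dj) auto
    also have "\<dots> \<le> (\<integral>\<^sup>+C. emeasure lborel C \<partial>count_space (components U))"
      using op by (intro nn_integral_mono emeasure_connected_le_lborel sets Icc)
        (auto simp: in_components_connected)
    also have "\<dots> = emeasure lborel (\<Union>C\<in>components U. C)"
      using op by (intro emeasure_UN_countable[symmetric] cnt dj) auto
    finally show ?thesis by simp
  qed
  have "emeasure N E \<le> emeasure lborel E" if E: "E \<in> sets borel" for E
  proof (rule ennreal_le_epsilon)
    fix e :: real assume "0 < e"
    then obtain U where U: "open U" "E \<subseteq> U" "emeasure lborel (U - E) < e"
      using outer_regular_lborel[OF E] by blast
    have "emeasure N E \<le> emeasure N U"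
      using U sets by (intro emeasure_mono) auto
    also have "\<dots> \<le> emeasure lborel (E \<union> (U - E))"
      using opn[OF U(1)] U(2) by (simp add: Un_absorb1)
    also have "\<dots> \<le> emeasure lborel E + emeasure lborel (U - E)"
      using E U by (intro emeasure_subadditive) auto
    also have "\<dots> \<le> emeasure lborel E + e"
      using U by (intro add_left_mono) auto
    finally show "emeasure N E \<le> emeasure lborel E + e" .
  qed
  \<comment> \<open>The order on measures compares all sets; off the Borel sets both sides are
    \<open>0\<close> by default.\<close>
  then have "emeasure N \<le> emeasure lborel"
    using sets by (intro le_funI) (metis emeasure_notin_sets le_zero_eq order_refl sets_lborel zero_le)
  then show ?thesis
    using sets sets_eq_imp_space_eq[OF sets] by (auto simp: le_measure_iff)
qed

section \<open>Quantile functions and the interpolated change of variables\<close>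

abbreviation unit_lborel :: "real measure" where
  "unit_lborel \<equiv> restrict_space lborel {0<..<1}"

lemma quantile_exists:
  fixes p :: "real \<Rightarrow> ennreal"
  assumes [measurable]: "p \<in> borel_measurable borel" and "(\<integral>\<^sup>+x. p x \<partial>lborel) = 1"
  obtains X where "X \<in> borel_measurable unit_lborel" "mono_on {0<..<1} X"
    "distr unit_lborel borel X = density lborel p"
proof -
  have "prob_space (density lborel p)"
    using assms by (intro prob_spaceI) (simp add: emeasure_density)
  then interpret cdf_distribution "density lborel p"
    by (simp add: cdf_distribution_def real_distribution_def real_distribution_axioms_def)
  show thesis
  proof (rule that)
    \<comment> \<open>\<open>I\<close> is the generalised inverse of the distribution
      function.\<close>
    show "I \<in> borel_measurable unit_lborel"
      using measurable_CI by (simp cong: measurable_cong_sets add: sets_restrict_space)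
  qed (rule mono_I, rule distr_I_eq_M)
qed

text \<open>Formally \<open>inverse (p (X w))\<close> is the derivative of \<open>X\<close>, and a
  monotone function grows at least by the integral of its derivative; jumps of \<open>X\<close> make
  this an inequality. Instead of differentiating, the proof pushes forward along \<open>X\<close>,
  which turns the weight into \<open>p * inverse p\<close>.\<close>

lemma nn_integral_inverse_density_quantile:
  fixes p :: "real \<Rightarrow> ennreal"
  assumes [measurable]: "p \<in> borel_measurable borel" "X \<in> borel_measurable unit_lborel"
    and mono: "mono_on {0<..<1} X"
    and distr: "distr unit_lborel borel X = density lborel p"
    and u: "0 < u" "u \<le> v" "v < 1"
  shows "(\<integral>\<^sup>+w. inverse (p (X w)) * indicator {u..v} w \<partial>unit_lborel) \<le> ennreal (X v - X u)"
proof -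
  have "(\<integral>\<^sup>+w. inverse (p (X w)) * indicator {u..v} w \<partial>unit_lborel)
      \<le> (\<integral>\<^sup>+w. inverse (p (X w)) * indicator {X u..X v} (X w) \<partial>unit_lborel)"
    using u mono
    by (intro nn_integral_mono mult_left_mono)
       (auto simp: space_restrict_space indicator_def monotone_on_def)
  also have "\<dots> = (\<integral>\<^sup>+x. inverse (p x) * indicator {X u..X v} x \<partial>density lborel p)"
    unfolding distr[symmetric] by (subst nn_integral_distr) auto
  also have "\<dots> = (\<integral>\<^sup>+x. p x * (inverse (p x) * indicator {X u..X v} x) \<partial>lborel)"
    by (subst nn_integral_density) auto
  also have "\<dots> \<le> (\<integral>\<^sup>+x. indicator {X u..X v} x \<partial>lborel)"
  proof (intro nn_integral_mono)
    fix x
    \<comment> \<open>At \<open>p x = 0\<close> and at \<open>p x = top\<close> the product is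
      \<open>0\<close> in \<open>ennreal\<close>; elsewhere it is \<open>1\<close>.\<close>
    have "p x * inverse (p x) \<le> 1"
      by (cases "p x = 0 \<or> p x = top") (auto simp: less_top divide_ennreal_def[symmetric] ennreal_divide_self)
    then show "p x * (inverse (p x) * indicator {X u..X v} x) \<le> indicator {X u..X v} x"
      by (auto simp: indicator_def)
  qed
  also have "\<dots> = ennreal (X v - X u)"
    using mono u by (auto simp: monotone_on_def)
  finally show ?thesis .
qed

text \<open>The endpoints of \<open>U\<close> are null, and its interior is exhausted by closed
  intervals with endpoints in \<open>U\<close>; monotone convergence does the rest.\<close>

lemma nn_integral_connected_le:
  fixes W :: "real \<Rightarrow> ennreal"
  assumes W[measurable]: "W \<in> borel_measurable borel"
    and U: "connected U" "bounded U"
    and le: "\<And>u v. u \<in> U \<Longrightarrow> v \<in> U \<Longrightarrow> u \<le> v \<Longrightarrow> (\<integral>\<^sup>+w. W w * indicator {u..v} w \<partial>lborel) \<le> c"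
  shows "(\<integral>\<^sup>+w. W w * indicator U w \<partial>lborel) \<le> c"
proof (cases "U = {}")
  case False
  define l r where "l = Inf U" and "r = Sup U"
  have bdd: "bdd_below U" "bdd_above U"
    using U by (auto dest: bounded_imp_bdd_below bounded_imp_bdd_above)
  have sub: "U \<subseteq> {l..r}"
    using bdd by (auto simp: l_def r_def intro: cInf_lower cSup_upper)
  have mem: "u \<in> U" if lu: "l < u" and ur: "u < r" for u
  proof -
    obtain x where "x \<in> U" "x < u"
      using lu unfolding l_def cInf_less_iff[OF False bdd(1)] by blast
    moreover obtain y where "y \<in> U" "u < y"
      using ur unfolding r_def less_cSup_iff[OF False bdd(2)] by blast
    ultimately show ?thesis
      using connected_contains_Icc[OF U(1), of x y] by auto
  qed
  have "AE w in lborel. w \<noteq> l" "AE w in lborel. w \<noteq> r"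
    by (rule AE_lborel_singleton)+
  then have "AE w in lborel. W w * indicator U w = W w * indicator {l<..<r} w"
  proof eventually_elim
    case (elim w)
    then show ?case
      using sub mem[of w] by (force simp: indicator_def)
  qed
  then have "(\<integral>\<^sup>+w. W w * indicator U w \<partial>lborel) = (\<integral>\<^sup>+w. W w * indicator {l<..<r} w \<partial>lborel)"
    by (rule nn_integral_cong_AE)
  also have "\<dots> \<le> c"
  proof (cases "l < r")
    case True
    \<comment> \<open>The \<open>+ 2\<close> keeps the margin at most half of \<open>r - l\<close>,
      so that no \<open>A n\<close> is empty.\<close>
    define A where "A n = {l + (r - l) / (real n + 2)..r - (r - l) / (real n + 2)}" for n
    have inc: "incseq A"
      using True by (auto simp: incseq_def A_def intro!: divide_left_mono add_mono diff_mono
          intro: order_trans)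
    have Un: "(\<Union>n. A n) = {l<..<r}"
    proof (intro equalityI subsetI)
      fix w assume "w \<in> {l<..<r}"
      then have "0 < min (w - l) (r - w)" by auto
      then obtain n where n: "inverse (real (Suc n)) < min (w - l) (r - w) / (r - l)"
        using True by (meson reals_Archimedean diff_gt_0_iff_gt divide_pos_pos)
      have "(r - l) / (real n + 2) \<le> (r - l) * inverse (real (Suc n))"
        using True by (simp add: divide_inverse mult_left_mono)
      also have "\<dots> < min (w - l) (r - w)"
        using n True by (simp add: field_simps)
      finally have "w \<in> A n"
        by (auto simp: A_def)
      then show "w \<in> (\<Union>n. A n)" by auto
    next
      fix w assume "w \<in> (\<Union>n. A n)"
      moreover have "0 < (r - l) / (real n + 2)" for n
        using True by auto
      ultimately show "w \<in> {l<..<r}"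
        unfolding A_def by (auto intro: less_le_trans le_less_trans) (smt (verit))+
    qed
    have "(\<integral>\<^sup>+w. W w * indicator {l<..<r} w \<partial>lborel) = emeasure (density lborel W) (\<Union>n. A n)"
      by (simp add: emeasure_density Un)
    also have "\<dots> = (SUP n. emeasure (density lborel W) (A n))"
    proof (rule SUP_emeasure_incseq[symmetric])
      show "range A \<subseteq> sets (density lborel W)"
        by (auto simp: A_def)
    qed fact
    also have "\<dots> \<le> c"
    proof (rule SUP_least)
      fix n
      have *: "(r - l) / (real n + 2) > 0" "(r - l) / (real n + 2) \<le> (r - l) / 2"
        using True divide_left_mono[of 2 "real n + 2" "r - l"] by auto
      have **: "l + (r - l) / (real n + 2) \<le> r - (r - l) / (real n + 2)"
        using * by argo
      have "(\<integral>\<^sup>+w. W w * indicator (A n) w \<partial>lborel) \<le> c"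
        unfolding A_def
      proof (rule le)
        show "l + (r - l) / (real n + 2) \<in> U" "r - (r - l) / (real n + 2) \<in> U"
          using * ** by (intro mem; linarith)+
      qed fact
      then show "emeasure (density lborel W) (A n) \<le> c"
        by (subst emeasure_density) (auto simp: A_def)
    qed
    finally show ?thesis .
  qed simp
  finally show ?thesis .
qed simp

text \<open>Change of variables along \<open>z = (1 - s) * X + s * Y\<close>, with the weight
  \<open>w\<close> in the role of the derivative. As \<open>z\<close> is monotone, preimages of
  intervals are intervals, where the integral of \<open>w\<close> is at most the increment of
  \<open>z\<close>; hence the image of \<open>w du\<close> under \<open>z\<close> is dominated by
  Lebesgue measure.\<close>

lemma nn_integral_interpolated_quantile_le:
  fixes p q :: "real \<Rightarrow> ennreal"
  assumes [measurable]: "p \<in> borel_measurable borel" "X \<in> borel_measurable unit_lborel"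
    "q \<in> borel_measurable borel" "Y \<in> borel_measurable unit_lborel"
    and X: "mono_on {0<..<1} X" "distr unit_lborel borel X = density lborel p"
    and Y: "mono_on {0<..<1} Y" "distr unit_lborel borel Y = density lborel q"
    and s: "0 \<le> s" "s \<le> 1" and [measurable]: "\<phi> \<in> borel_measurable borel"
  shows "(\<integral>\<^sup>+u. (ennreal (1 - s) * inverse (p (X u)) + ennreal s * inverse (q (Y u)))
            * \<phi> ((1 - s) * X u + s * Y u) \<partial>unit_lborel) \<le> (\<integral>\<^sup>+z. \<phi> z \<partial>lborel)"
proof -
  define w where "w u = ennreal (1 - s) * inverse (p (X u)) + ennreal s * inverse (q (Y u))" for u
  define z where "z u = (1 - s) * X u + s * Y u" for u
  have [measurable]: "w \<in> borel_measurable unit_lborel" "z \<in> borel_measurable unit_lborel"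
    unfolding w_def z_def by measurable
  define N where "N = distr (density unit_lborel w) borel z"
  have z_mono: "z u \<le> z v" if "0 < u" "u \<le> v" "v < 1" for u v
    using X(1) Y(1) s that
    by (auto simp: z_def monotone_on_def intro!: add_mono mult_left_mono)
  define W where "W u = w u * indicator {0<..<1} u" for u
  have [measurable]: "W \<in> borel_measurable borel"
  proof -
    have "w \<in> borel_measurable (restrict_space borel {0<..<1})"
      using \<open>w \<in> borel_measurable unit_lborel\<close>
      by (simp cong: measurable_cong_sets add: sets_restrict_space)
    then show ?thesis
      unfolding W_def by (subst (asm) borel_measurable_restrict_space_iff_ennreal) auto
  qed
  have piece: "(\<integral>\<^sup>+t. W t * indicator {u..v} t \<partial>lborel) \<le> ennreal (z v - z u)"
    if uv: "0 < u" "u \<le> v" "v < 1" for u v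
  proof -
    have [measurable]: "(indicator {u..v} :: real \<Rightarrow> ennreal) \<in> borel_measurable unit_lborel"
      by (rule measurable_restrict_space1) simp
    have mX: "X u \<le> X v" "Y u \<le> Y v"
      using X(1) Y(1) uv by (auto simp: monotone_on_def)
    have "(\<integral>\<^sup>+t. W t * indicator {u..v} t \<partial>lborel) = (\<integral>\<^sup>+t. w t * indicator {u..v} t \<partial>unit_lborel)"
      unfolding W_def by (subst nn_integral_restrict_space) (auto simp: ac_simps)
    also have "\<dots> = (\<integral>\<^sup>+t. ennreal (1 - s) * (inverse (p (X t)) * indicator {u..v} t)
          + ennreal s * (inverse (q (Y t)) * indicator {u..v} t) \<partial>unit_lborel)"
      by (intro nn_integral_cong) (simp add: w_def algebra_simps)
    also have "\<dots> = ennreal (1 - s) * (\<integral>\<^sup>+t. inverse (p (X t)) * indicator {u..v} t \<partial>unit_lborel)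
          + ennreal s * (\<integral>\<^sup>+t. inverse (q (Y t)) * indicator {u..v} t \<partial>unit_lborel)"
      by (subst nn_integral_add) (auto simp: nn_integral_cmult)
    also have "\<dots> \<le> ennreal (1 - s) * ennreal (X v - X u) + ennreal s * ennreal (Y v - Y u)"
      using uv X Y by (intro add_mono mult_left_mono nn_integral_inverse_density_quantile) auto
    also have "\<dots> = ennreal ((1 - s) * (X v - X u) + s * (Y v - Y u))"
      using s mX by (simp add: ennreal_mult)
    also have "(1 - s) * (X v - X u) + s * (Y v - Y u) = z v - z u"
      by (simp add: z_def algebra_simps)
    finally show ?thesis .
  qed
  have "N \<le> lborel"
  proof (rule le_lborel_if_Icc_le)
    show "sets N = sets borel" by (simp add: N_def)
    fix a b :: real assume ab: "a \<le> b"
    define U where "U = {u\<in>{0<..<1}. a \<le> z u \<and> z u \<le> b}"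
    have "emeasure N {a..b} = emeasure (density unit_lborel w) (z -` {a..b} \<inter> space unit_lborel)"
      unfolding N_def by (subst emeasure_distr) auto
    also have "\<dots> = (\<integral>\<^sup>+u. w u * indicator (z -` {a..b} \<inter> space unit_lborel) u \<partial>unit_lborel)"
      by (intro emeasure_density measurable_sets[of z _ borel]) auto
    also have "\<dots> = (\<integral>\<^sup>+u. W u * indicator U u \<partial>lborel)"
      unfolding W_def U_def
      by (subst nn_integral_restrict_space)
         (auto intro!: nn_integral_cong simp: indicator_def space_restrict_space)
    also have "\<dots> \<le> ennreal (b - a)"
    proof (rule nn_integral_connected_le)
      show "bounded U"
        by (rule bounded_subset[of "{0..1}"]) (auto simp: U_def)
      have "is_interval U"
        unfolding is_interval_1 U_def using z_mono
        by (auto; meson order_trans less_le_trans le_less_trans)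
      then show "connected U"
        by (simp add: is_interval_connected_1)
      fix u v assume "u \<in> U" "v \<in> U" "u \<le> v"
      then show "(\<integral>\<^sup>+w. W w * indicator {u..v} w \<partial>lborel) \<le> ennreal (b - a)"
        using piece[of u v] by (auto simp: U_def elim!: order_trans intro!: ennreal_leI)
    qed simp
    finally show "emeasure N {a..b} \<le> ennreal (b - a)" .
  qed
  then have "(\<integral>\<^sup>+z. \<phi> z \<partial>N) \<le> (\<integral>\<^sup>+z. \<phi> z \<partial>lborel)"
    by (intro nn_integral_mono_measure) (auto simp: N_def)
  also have "(\<integral>\<^sup>+z. \<phi> z \<partial>N) = (\<integral>\<^sup>+u. w u * \<phi> (z u) \<partial>unit_lborel)"
    unfolding N_def by (simp add: nn_integral_distr nn_integral_density)
  finally show ?thesis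
    by (simp add: w_def z_def)
qed

text \<open>The values of \<open>geom_weight\<close> at \<open>0\<close> and \<open>top\<close> are junk: all uses are guarded by \<open>0 < a\<close>,
  \<open>a < top\<close> and likewise for \<open>b\<close>.\<close>

definition geom_weight :: "real \<Rightarrow> ennreal \<Rightarrow> ennreal \<Rightarrow> ennreal" where
  "geom_weight s a b = ennreal (enn2real a powr (s - 1) * enn2real b powr (- s))"

section \<open>Geometric-mean weights and the inequality in one dimension\<close>

lemma borel_measurable_geom_weight[measurable]:
  assumes [measurable]: "s \<in> borel_measurable M" "a \<in> borel_measurable M" "b \<in> borel_measurable M"
  shows "(\<lambda>x. geom_weight (s x) (a x) (b x)) \<in> borel_measurable M"
  unfolding geom_weight_def by measurable

text \<open>The weight is the reciprocal of the geometric mean \<open>a^(1-s) * b^s\<close>, so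
  \<open>F\<close> and \<open>G\<close> factor out, and Young's inequality bounds what remains by an
  arithmetic mean. With \<open>a / F\<close> and \<open>b / G\<close> as normalised densities, that
  mean is the derivative weight of the interpolated quantiles.\<close>

lemma geom_weight_rescale_le:
  assumes "0 \<le> s" "s \<le> 1" "0 < F" "F < top" "0 < G" "G < top"
    and "0 < a" "a < top" "0 < b" "b < top"
  shows "geom_weight s a b
    \<le> geom_weight s F G * (ennreal (1 - s) * inverse (a / F) + ennreal s * inverse (b / G))"
proof -
  obtain a' b' F' G' where e: "a = ennreal a'" "b = ennreal b'" "F = ennreal F'" "G = ennreal G'"
    and pos: "0 < a'" "0 < b'" "0 < F'" "0 < G'"
    using assms by (cases a; cases b; cases F; cases G) auto
  have "a' powr (s - 1) * b' powr (- s)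
      = (F' powr (s - 1) * G' powr (- s)) * ((F' / a') powr (1 - s) * (G' / b') powr s)"
    using pos by (simp add: powr_divide powr_diff powr_minus field_simps)
  also have "\<dots> \<le> (F' powr (s - 1) * G' powr (- s)) * ((1 - s) * (F' / a') + s * (G' / b'))"
    using pos assms by (intro mult_left_mono Youngs_inequality_0) auto
  finally have "ennreal (a' powr (s - 1) * b' powr (- s))
     \<le> ennreal ((F' powr (s - 1) * G' powr (- s)) * ((1 - s) * (F' / a') + s * (G' / b')))"
    by (rule ennreal_leI)
  also have "\<dots> = ennreal (F' powr (s - 1) * G' powr (- s))
      * (ennreal (1 - s) * ennreal (F' / a') + ennreal s * ennreal (G' / b'))"
    using pos assms by (simp add: ennreal_mult ennreal_plus del: times_divide_eq_right)
  also have "ennreal (F' / a') = inverse (a / F)"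
    using pos unfolding e by (simp add: divide_ennreal inverse_ennreal)
  also have "ennreal (G' / b') = inverse (b / G)"
    using pos unfolding e by (simp add: divide_ennreal inverse_ennreal)
  finally show ?thesis
    using pos by (simp add: geom_weight_def e)
qed

lemma AE_quantile_density:
  fixes p :: "real \<Rightarrow> ennreal"
  assumes [measurable]: "p \<in> borel_measurable borel" "X \<in> borel_measurable unit_lborel"
    and "(\<integral>\<^sup>+x. p x \<partial>lborel) \<noteq> top"
    and "distr unit_lborel borel X = density lborel p"
  shows "AE u in unit_lborel. 0 < p (X u) \<and> p (X u) < top"
proof -
  have "AE x in lborel. p x \<noteq> top"
    using assms nn_integral_PInf_AE[of p lborel] by auto
  then have "AE x in density lborel p. 0 < p x \<and> p x < top"
    by (subst AE_density) (auto simp: less_top)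
  then have "AE x in distr unit_lborel borel X. 0 < p x \<and> p x < top"
    unfolding assms(4) .
  then show ?thesis
    by (rule AE_distrD[rotated]) simp
qed

lemma sigma_finite_unit_lborel: "sigma_finite_measure unit_lborel"
  by (rule sigma_finite_measure_restrict_space) (auto intro: sigma_finite_lborel)

lemma nn_integral_const_unit_lborel: "(\<integral>\<^sup>+u. c \<partial>unit_lborel) = c"
  by (simp add: emeasure_restrict_space space_restrict_space)

text \<open>The hypothesis is applied to the coupled points \<open>X u\<close> and
  \<open>Y u\<close> and averaged over \<open>u\<close>. Rescaling splits the weight into a factor
  independent of \<open>u\<close> and the derivative weight; for fixed \<open>s\<close> the latter
  is absorbed by the change of variables.\<close>

lemma interpolation_inequality_real:
  fixes f g :: "real \<Rightarrow> ennreal" and h :: "real \<times> real \<Rightarrow> ennreal"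
  assumes \<sigma>: "sigma_finite_measure \<sigma>" and [measurable_cong]: "sets \<sigma> = sets borel"
    and supp: "AE s in \<sigma>. 0 \<le> s \<and> s \<le> 1"
    and [measurable]: "f \<in> borel_measurable borel" "g \<in> borel_measurable borel"
      "h \<in> borel_measurable (borel \<Otimes>\<^sub>M borel)"
    and F: "0 < (\<integral>\<^sup>+x. f x \<partial>lborel)" "(\<integral>\<^sup>+x. f x \<partial>lborel) < top"
    and G: "0 < (\<integral>\<^sup>+x. g x \<partial>lborel)" "(\<integral>\<^sup>+x. g x \<partial>lborel) < top"
    and hyp: "\<And>x y. 0 < f x \<Longrightarrow> f x < top \<Longrightarrow> 0 < g y \<Longrightarrow> g y < top \<Longrightarrow>
      \<theta> \<le> (\<integral>\<^sup>+s. h (s, (1 - s) * x + s * y) * geom_weight s (f x) (g y) \<partial>\<sigma>)"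
  shows "\<theta> \<le> (\<integral>\<^sup>+s. (\<integral>\<^sup>+z. h (s, z) \<partial>lborel)
    * geom_weight s (\<integral>\<^sup>+x. f x \<partial>lborel) (\<integral>\<^sup>+x. g x \<partial>lborel) \<partial>\<sigma>)"
proof -
  define Fi Gi where "Fi = (\<integral>\<^sup>+x. f x \<partial>lborel)" and "Gi = (\<integral>\<^sup>+x. g x \<partial>lborel)"
  note FG = F[folded Fi_def] G[folded Gi_def]
  define p q where "p x = f x / Fi" and "q x = g x / Gi" for x
  have [measurable]: "p \<in> borel_measurable borel" "q \<in> borel_measurable borel"
    unfolding p_def q_def by measurable
  have int: "(\<integral>\<^sup>+x. p x \<partial>lborel) = 1" "(\<integral>\<^sup>+x. q x \<partial>lborel) = 1"
    using FG unfolding p_def q_def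
    by (auto simp: nn_integral_divide Fi_def[symmetric] Gi_def[symmetric] ennreal_divide_self)
  obtain X where X[measurable]: "X \<in> borel_measurable unit_lborel" and X': "mono_on {0<..<1} X"
    "distr unit_lborel borel X = density lborel p"
    using quantile_exists[OF _ int(1)] by auto
  obtain Y where Y[measurable]: "Y \<in> borel_measurable unit_lborel" and Y': "mono_on {0<..<1} Y"
    "distr unit_lborel borel Y = density lborel q"
    using quantile_exists[OF _ int(2)] by auto
  interpret \<sigma>: sigma_finite_measure \<sigma> by fact
  interpret \<Omega>: sigma_finite_measure unit_lborel by (rule sigma_finite_unit_lborel)
  interpret P: pair_sigma_finite unit_lborel \<sigma> ..
  let ?z = "\<lambda>s u. (1 - s) * X u + s * Y u"
  let ?w = "\<lambda>s u. ennreal (1 - s) * inverse (p (X u)) + ennreal s * inverse (q (Y u))"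
  let ?g = "\<lambda>s. geom_weight s Fi Gi"
  have "\<theta> = (\<integral>\<^sup>+u. \<theta> \<partial>unit_lborel)"
    by (rule nn_integral_const_unit_lborel[symmetric])
  also have "\<dots> \<le> (\<integral>\<^sup>+u. (\<integral>\<^sup>+s. ?g s * (?w s u * h (s, ?z s u)) \<partial>\<sigma>) \<partial>unit_lborel)"
  proof (rule nn_integral_mono_AE)
    have "AE u in unit_lborel. 0 < p (X u) \<and> p (X u) < top"
      using int X' by (intro AE_quantile_density) auto
    moreover have "AE u in unit_lborel. 0 < q (Y u) \<and> q (Y u) < top"
      using int Y' by (intro AE_quantile_density) auto
    ultimately show "AE u in unit_lborel. \<theta> \<le> (\<integral>\<^sup>+s. ?g s * (?w s u * h (s, ?z s u)) \<partial>\<sigma>)"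
    proof eventually_elim
      case (elim u)
      then have fg: "0 < f (X u)" "f (X u) < top" "0 < g (Y u)" "g (Y u) < top"
        using FG unfolding p_def q_def
        by (auto simp: ennreal_zero_less_divide less_top[symmetric] ennreal_divide_eq_top_iff)
      have "\<theta> \<le> (\<integral>\<^sup>+s. h (s, ?z s u) * geom_weight s (f (X u)) (g (Y u)) \<partial>\<sigma>)"
        using fg by (rule hyp)
      also have "\<dots> \<le> (\<integral>\<^sup>+s. ?g s * (?w s u * h (s, ?z s u)) \<partial>\<sigma>)"
        using supp
      proof (intro nn_integral_mono_AE, eventually_elim)
        case (elim s)
        have "geom_weight s (f (X u)) (g (Y u)) \<le> ?g s * ?w s u"
          unfolding p_def q_def using elim fg FG by (intro geom_weight_rescale_le) auto
        then have "h (s, ?z s u) * geom_weight s (f (X u)) (g (Y u)) \<le> h (s, ?z s u) * (?g s * ?w s u)"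
          by (rule mult_left_mono) simp
        then show ?case
          by (simp add: ac_simps)
      qed
      finally show ?case .
    qed
  qed
  \<comment> \<open>The order is exchanged because the change of variables acts in \<open>u\<close>
    for fixed \<open>s\<close>.\<close>
  also have "\<dots> = (\<integral>\<^sup>+s. (\<integral>\<^sup>+u. ?g s * (?w s u * h (s, ?z s u)) \<partial>unit_lborel) \<partial>\<sigma>)"
    by (rule P.Fubini'[symmetric]) measurable
  also have "\<dots> \<le> (\<integral>\<^sup>+s. (\<integral>\<^sup>+z. h (s, z) \<partial>lborel) * ?g s \<partial>\<sigma>)"
    using supp
  proof (intro nn_integral_mono_AE, eventually_elim)
    case (elim s)
    have "(\<integral>\<^sup>+u. ?g s * (?w s u * h (s, ?z s u)) \<partial>unit_lborel)
        = ?g s * (\<integral>\<^sup>+u. ?w s u * h (s, ?z s u) \<partial>unit_lborel)"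
      by (rule nn_integral_cmult) measurable
    also have "\<dots> \<le> ?g s * (\<integral>\<^sup>+z. h (s, z) \<partial>lborel)"
      using X' Y' elim
      by (intro mult_left_mono nn_integral_interpolated_quantile_le[where \<phi> = "\<lambda>z. h (s, z)"]) auto
    finally show ?case
      by (simp add: ac_simps)
  qed
  finally show ?thesis
    by (simp add: Fi_def Gi_def)
qed

section \<open>Tensorisation and transfer to Euclidean space\<close>

text \<open>Induction on the coordinates: the conclusion for slices at \<open>a\<close> and
  \<open>b\<close> is the one-dimensional hypothesis for the slice integrals. The slice of
  \<open>h\<close> is taken at \<open>(1 - s) * a + s * b\<close>, which is why \<open>h\<close>
  must be allowed to depend on \<open>s\<close>.\<close>

lemma interpolation_inequality_PiM:
  fixes h :: "real \<times> ('i \<Rightarrow> real) \<Rightarrow> ennreal"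
  assumes \<sigma>: "sigma_finite_measure \<sigma>" and sets\<sigma>[measurable_cong]: "sets \<sigma> = sets borel"
    and supp: "AE s in \<sigma>. 0 \<le> s \<and> s \<le> 1"
    and "finite I"
    and "f \<in> borel_measurable (PiM I (\<lambda>_. lborel))" "g \<in> borel_measurable (PiM I (\<lambda>_. lborel))"
      "h \<in> borel_measurable (borel \<Otimes>\<^sub>M PiM I (\<lambda>_. lborel))"
    and "0 < (\<integral>\<^sup>+x. f x \<partial>PiM I (\<lambda>_. lborel))" "(\<integral>\<^sup>+x. f x \<partial>PiM I (\<lambda>_. lborel)) < top"
    and "0 < (\<integral>\<^sup>+x. g x \<partial>PiM I (\<lambda>_. lborel))" "(\<integral>\<^sup>+x. g x \<partial>PiM I (\<lambda>_. lborel)) < top"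
    and "\<And>x y. x \<in> extensional I \<Longrightarrow> y \<in> extensional I \<Longrightarrow>
      0 < f x \<Longrightarrow> f x < top \<Longrightarrow> 0 < g y \<Longrightarrow> g y < top \<Longrightarrow>
      \<theta> \<le> (\<integral>\<^sup>+s. h (s, \<lambda>i\<in>I. (1 - s) * x i + s * y i) * geom_weight s (f x) (g y) \<partial>\<sigma>)"
  shows "\<theta> \<le> (\<integral>\<^sup>+s. (\<integral>\<^sup>+z. h (s, z) \<partial>PiM I (\<lambda>_. lborel))
    * geom_weight s (\<integral>\<^sup>+x. f x \<partial>PiM I (\<lambda>_. lborel)) (\<integral>\<^sup>+x. g x \<partial>PiM I (\<lambda>_. lborel)) \<partial>\<sigma>)"
  using assms(4-)
proof (induction I arbitrary: f g h rule: finite_induct)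
  case empty
  interpret L: product_sigma_finite "\<lambda>_::'i. lborel :: real measure" ..
  \<comment> \<open>The empty product is a point mass at \<open>\<lambda>_. undefined\<close>, where
    hypothesis and conclusion coincide.\<close>
  show ?case
    using empty(8)[of "\<lambda>_. undefined" "\<lambda>_. undefined"] empty(4-7)
    by (simp add: L.nn_integral_empty restrict_def)
next
  case (insert i I)
  interpret L: product_sigma_finite "\<lambda>_::'i. lborel :: real measure" ..
  let ?P = "PiM I (\<lambda>_. lborel :: real measure)"
  let ?Q = "PiM (insert i I) (\<lambda>_. lborel :: real measure)"
  note [measurable] = insert.prems(1,2,3)
  interpret P: sigma_finite_measure ?P
    by (rule L.sigma_finite) fact
  have upd[measurable]: "(\<lambda>(z, a). z(i := a)) \<in> measurable (?P \<Otimes>\<^sub>M lborel) ?Q"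
    by (rule measurable_add_dim)
  have upd1[measurable]: "(\<lambda>z. z(i := a)) \<in> measurable ?P ?Q" for a
    using measurable_compose[OF measurable_Pair2' upd] by (auto simp: measurable_Pair2')
  define f1 where "f1 a = (\<integral>\<^sup>+x. f (x(i := a)) \<partial>?P)" for a
  define g1 where "g1 a = (\<integral>\<^sup>+x. g (x(i := a)) \<partial>?P)" for a
  define h1 where "h1 v = (\<integral>\<^sup>+z. h (fst v, z(i := snd v)) \<partial>?P)" for v
  have [measurable]: "f1 \<in> borel_measurable borel"
  proof -
    have "(\<lambda>(a, z). f (z(i := a))) \<in> borel_measurable (lborel \<Otimes>\<^sub>M ?P)"
      using measurable_compose[OF measurable_pair_swap' measurable_compose[OF upd insert.prems(1)]]
      by (simp add: split_beta')
    from P.borel_measurable_nn_integral[OF this] show ?thesis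
      by (simp add: f1_def[abs_def])
  qed
  have [measurable]: "g1 \<in> borel_measurable borel"
  proof -
    have "(\<lambda>(a, z). g (z(i := a))) \<in> borel_measurable (lborel \<Otimes>\<^sub>M ?P)"
      using measurable_compose[OF measurable_pair_swap' measurable_compose[OF upd insert.prems(2)]]
      by (simp add: split_beta')
    from P.borel_measurable_nn_integral[OF this] show ?thesis
      by (simp add: g1_def[abs_def])
  qed
  have [measurable]: "h1 \<in> borel_measurable (borel \<Otimes>\<^sub>M borel)"
  proof -
    have "(\<lambda>w. (snd w, snd (fst w))) \<in> measurable ((borel \<Otimes>\<^sub>M borel) \<Otimes>\<^sub>M ?P) (?P \<Otimes>\<^sub>M lborel)"
      by measurable
    from measurable_compose[OF this upd]
    have [measurable]: "(\<lambda>w. (snd w)(i := snd (fst w))) \<in> measurable ((borel \<Otimes>\<^sub>M borel) \<Otimes>\<^sub>M ?P) ?Q"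
      by simp
    have "(\<lambda>(v, z). h (fst v, z(i := snd v))) \<in> borel_measurable ((borel \<Otimes>\<^sub>M borel) \<Otimes>\<^sub>M ?P)"
      unfolding split_beta' by measurable
    from P.borel_measurable_nn_integral[OF this] show ?thesis
      by (simp add: h1_def[abs_def])
  qed
  have f1: "(\<integral>\<^sup>+x. f x \<partial>?Q) = (\<integral>\<^sup>+a. f1 a \<partial>lborel)"
    unfolding f1_def using insert.hyps by (intro L.product_nn_integral_insert_rev) auto
  have g1: "(\<integral>\<^sup>+x. g x \<partial>?Q) = (\<integral>\<^sup>+a. g1 a \<partial>lborel)"
    unfolding g1_def using insert.hyps by (intro L.product_nn_integral_insert_rev) auto
  have h1: "(\<integral>\<^sup>+z. h (s, z) \<partial>?Q) = (\<integral>\<^sup>+c. h1 (s, c) \<partial>lborel)" for s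
    unfolding h1_def fst_conv snd_conv
    using insert.hyps by (intro L.product_nn_integral_insert_rev) auto
  show ?case
    unfolding f1 g1 h1
  proof (rule interpolation_inequality_real[OF \<sigma> sets\<sigma> supp])
    show "0 < (\<integral>\<^sup>+a. f1 a \<partial>lborel)" "(\<integral>\<^sup>+a. f1 a \<partial>lborel) < top"
      "0 < (\<integral>\<^sup>+a. g1 a \<partial>lborel)" "(\<integral>\<^sup>+a. g1 a \<partial>lborel) < top"
      using insert.prems(4-7) by (simp_all add: f1 g1)
    fix a b assume ab: "0 < f1 a" "f1 a < top" "0 < g1 b" "g1 b < top"
    have "\<theta> \<le> (\<integral>\<^sup>+s. (\<integral>\<^sup>+z. h (s, z(i := (1 - s) * a + s * b)) \<partial>?P)
        * geom_weight s (\<integral>\<^sup>+x. f (x(i := a)) \<partial>?P) (\<integral>\<^sup>+x. g (x(i := b)) \<partial>?P) \<partial>\<sigma>)"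
    proof (rule insert.IH[of "\<lambda>x. f (x(i := a))" "\<lambda>y. g (y(i := b))"
          "\<lambda>v. h (fst v, (snd v)(i := (1 - fst v) * a + fst v * b))", unfolded fst_conv snd_conv])
      have "(\<lambda>v. (snd v, (1 - fst v) * a + fst v * b)) \<in> measurable (borel \<Otimes>\<^sub>M ?P) (?P \<Otimes>\<^sub>M lborel)"
        by measurable
      from measurable_compose[OF this upd]
      have [measurable]: "(\<lambda>v. (snd v)(i := (1 - fst v) * a + fst v * b)) \<in> measurable (borel \<Otimes>\<^sub>M ?P) ?Q"
        by simp
      show "(\<lambda>v. h (fst v, (snd v)(i := (1 - fst v) * a + fst v * b))) \<in> borel_measurable (borel \<Otimes>\<^sub>M ?P)"
        by measurable
      fix x y assume xy: "x \<in> extensional I" "y \<in> extensional I"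
        "0 < f (x(i := a))" "f (x(i := a)) < top" "0 < g (y(i := b))" "g (y(i := b)) < top"
      have eq: "(\<lambda>j\<in>insert i I. (1 - s) * (x(i := a)) j + s * (y(i := b)) j)
          = (\<lambda>j\<in>I. (1 - s) * x j + s * y j)(i := (1 - s) * a + s * b)" for s
        using insert.hyps by (auto simp: fun_eq_iff restrict_def)
      have ext: "x(i := a) \<in> extensional (insert i I)" "y(i := b) \<in> extensional (insert i I)"
        using xy by (auto simp: extensional_def)
      show "\<theta> \<le> (\<integral>\<^sup>+s. h (s, (\<lambda>j\<in>I. (1 - s) * x j + s * y j)(i := (1 - s) * a + s * b))
          * geom_weight s (f (x(i := a))) (g (y(i := b))) \<partial>\<sigma>)"
        using insert.prems(8)[OF ext xy(3-)] unfolding eq .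
    qed (use ab in \<open>auto simp: f1_def g1_def\<close>)
    then show "\<theta> \<le> (\<integral>\<^sup>+s. h1 (s, (1 - s) * a + s * b) * geom_weight s (f1 a) (g1 b) \<partial>\<sigma>)"
      by (simp add: f1_def g1_def h1_def)
  qed auto
qed

text \<open>For indicator functions the weights in the hypothesis are
  \<open>geom_weight s 1 1 = 1\<close>, so the integral there is the \<open>\<sigma>\<close>-time
  that the segment spends in \<open>C\<close>.\<close>

lemma interpolation_inequality_sets:
  fixes X Y C :: "'a::euclidean_space set"
  assumes \<sigma>: "sigma_finite_measure \<sigma>" and sets\<sigma>[measurable_cong]: "sets \<sigma> = sets borel"
    and supp: "AE s in \<sigma>. 0 \<le> s \<and> s \<le> 1"
    and [measurable]: "X \<in> sets borel" "Y \<in> sets borel" "C \<in> sets borel"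
    and X: "0 < emeasure lborel X" "emeasure lborel X < top"
    and Y: "0 < emeasure lborel Y" "emeasure lborel Y < top"
    and hyp: "\<And>x y. x \<in> X \<Longrightarrow> y \<in> Y \<Longrightarrow> \<theta> \<le> emeasure \<sigma> {s. (1 - s) *\<^sub>R x + s *\<^sub>R y \<in> C}"
  shows "\<theta> \<le> emeasure lborel C * (\<integral>\<^sup>+s. geom_weight s (emeasure lborel X) (emeasure lborel Y) \<partial>\<sigma>)"
proof -
  let ?P = "PiM Basis (\<lambda>_. lborel :: real measure) :: ('a \<Rightarrow> real) measure"
  define e :: "('a \<Rightarrow> real) \<Rightarrow> 'a" where "e x = (\<Sum>b\<in>Basis. x b *\<^sub>R b)" for x
  have [measurable]: "e \<in> measurable ?P borel"
    unfolding e_def by measurable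
  have int: "(\<integral>\<^sup>+x. indicator A (e x) \<partial>?P) = emeasure lborel A" if [measurable]: "A \<in> sets borel" for A
  proof -
    have "emeasure lborel A = (\<integral>\<^sup>+x. indicator A x \<partial>distr ?P borel e)"
      unfolding e_def lborel_eq[symmetric] by simp
    also have "\<dots> = (\<integral>\<^sup>+x. indicator A (e x) \<partial>?P)"
      by (rule nn_integral_distr) auto
    finally show ?thesis by simp
  qed
  have "\<theta> \<le> (\<integral>\<^sup>+s. (\<integral>\<^sup>+z. indicator C (e z) \<partial>?P)
    * geom_weight s (\<integral>\<^sup>+x. indicator X (e x) \<partial>?P) (\<integral>\<^sup>+x. indicator Y (e x) \<partial>?P) \<partial>\<sigma>)"
  proof (rule interpolation_inequality_PiM[OF \<sigma> sets\<sigma> supp, where h = "\<lambda>v. indicator C (e (snd v))",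
        unfolded snd_conv])
    fix x y :: "'a \<Rightarrow> real"
    assume "0 < (indicator X (e x) :: ennreal)" "0 < (indicator Y (e y) :: ennreal)"
    then have xy: "e x \<in> X" "e y \<in> Y"
      by (auto simp: indicator_def of_bool_def split: if_splits)
    have e: "e (\<lambda>i\<in>Basis. (1 - s) * x i + s * y i) = (1 - s) *\<^sub>R e x + s *\<^sub>R e y" for s
      by (simp add: e_def scaleR_sum_right sum.distrib scaleR_add_left)
    have "\<theta> \<le> emeasure \<sigma> {s. (1 - s) *\<^sub>R e x + s *\<^sub>R e y \<in> C}"
      using xy by (rule hyp)
    also have "\<dots> = (\<integral>\<^sup>+s. indicator {s. (1 - s) *\<^sub>R e x + s *\<^sub>R e y \<in> C} s \<partial>\<sigma>)"
      by (rule nn_integral_indicator[symmetric]) measurable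
    also have "\<dots> = (\<integral>\<^sup>+s. indicator C ((1 - s) *\<^sub>R e x + s *\<^sub>R e y) * geom_weight s 1 1 \<partial>\<sigma>)"
      by (intro nn_integral_cong) (auto simp: indicator_def geom_weight_def)
    finally show "\<theta> \<le> (\<integral>\<^sup>+s. indicator C (e (\<lambda>i\<in>Basis. (1 - s) * x i + s * y i))
        * geom_weight s (indicator X (e x)) (indicator Y (e y)) \<partial>\<sigma>)"
      using xy by (simp add: e)
  qed (use X Y in \<open>auto simp: int\<close>)
  also have "\<dots> = emeasure lborel C * (\<integral>\<^sup>+s. geom_weight s (emeasure lborel X) (emeasure lborel Y) \<partial>\<sigma>)"
    by (simp add: int nn_integral_cmult)
  finally show ?thesis .
qed

text \<open>Segments may meet a Lebesgue measurable set in a non-measurable set of times, hence the detour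
  through Borel supersets of \<open>C\<close> in the hypothesis.\<close>

lemma interpolation_inequality_vol:
  fixes X Y C :: "'a::euclidean_space set"
  assumes \<sigma>: "sigma_finite_measure \<sigma>" "sets \<sigma> = sets borel" "AE s in \<sigma>. 0 \<le> s \<and> s \<le> 1"
    and meas: "X \<in> lmeasurable" "Y \<in> lmeasurable" "C \<in> lmeasurable"
    and pos: "0 < vol X" "0 < vol Y"
    and hyp: "\<And>x y C'. x \<in> X \<Longrightarrow> y \<in> Y \<Longrightarrow> C' \<in> sets borel \<Longrightarrow> C \<subseteq> C' \<Longrightarrow>
      \<theta> \<le> emeasure \<sigma> {s. (1 - s) *\<^sub>R x + s *\<^sub>R y \<in> C'}"
  shows "\<theta> \<le> ennreal (vol C) * (\<integral>\<^sup>+s. ennreal (vol X powr (s - 1) * vol Y powr (- s)) \<partial>\<sigma>)"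
proof -
  \<comment> \<open>\<open>X\<close> and \<open>Y\<close> shrink to Borel sets and \<open>C\<close>
    grows to one, all without change of volume; these are the directions in which \<open>hyp\<close>
    survives.\<close>
  have inner: "\<exists>A'\<subseteq>A. A' \<in> sets borel \<and> emeasure lborel A' = ennreal (vol A)"
    if "A \<in> lmeasurable" for A :: "'a set"
  proof (intro exI[of _ "main_part lborel A"] conjI)
    have "A \<in> sets lebesgue"
      using that by (simp add: fmeasurableD)
    note A = main_part_null_part_Un[OF this] main_part_sets[OF this] emeasure_completion[OF this]
    show "main_part lborel A \<subseteq> A"
      using A(1) by auto
    show "main_part lborel A \<in> sets borel"
      using A(2) by simp
    show "emeasure lborel (main_part lborel A) = ennreal (vol A)"
      using A(3) that by (simp add: vol_def emeasure_eq_measure2)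
  qed
  obtain X' where X': "X' \<subseteq> X" "X' \<in> sets borel" "emeasure lborel X' = ennreal (vol X)"
    using inner[OF meas(1)] by auto
  obtain Y' where Y': "Y' \<subseteq> Y" "Y' \<in> sets borel" "emeasure lborel Y' = ennreal (vol Y)"
    using inner[OF meas(2)] by auto
  obtain C' where C': "C \<subseteq> C'" "C' \<in> sets borel" "emeasure lborel C' = ennreal (vol C)"
    using completion_upper[of C lborel] meas(3)
    by (metis emeasure_eq_measure2 fmeasurableD sets_lborel vol_def)
  have "\<theta> \<le> emeasure lborel C' * (\<integral>\<^sup>+s. geom_weight s (emeasure lborel X') (emeasure lborel Y') \<partial>\<sigma>)"
    using X' Y' C' pos by (intro interpolation_inequality_sets[OF \<sigma>] hyp) (auto simp: less_top)
  then show ?thesis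
    using X' Y' C' pos by (simp add: geom_weight_def)
qed

section \<open>Two choices of the measure on times\<close>

text \<open>The multiplicative Brunn--Minkowski inequality, from the point mass at \<open>t\<close>
  as \<open>\<sigma>\<close>.\<close>

lemma vol_interpolation_ge:
  fixes X Y C :: "'a::euclidean_space set"
  assumes meas: "X \<in> lmeasurable" "Y \<in> lmeasurable" "C \<in> lmeasurable"
    and pos: "0 < vol X" "0 < vol Y" and t: "0 \<le> t" "t \<le> 1"
    and hyp: "\<And>x y. x \<in> X \<Longrightarrow> y \<in> Y \<Longrightarrow> (1 - t) *\<^sub>R x + t *\<^sub>R y \<in> C"
  shows "vol X powr (1 - t) * vol Y powr t \<le> vol C"
proof -
  have "1 \<le> ennreal (vol C) * (\<integral>\<^sup>+s. ennreal (vol X powr (s - 1) * vol Y powr (- s)) \<partial>return borel t)"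
  proof (rule interpolation_inequality_vol[OF _ _ _ meas pos])
    show "sigma_finite_measure (return borel t)"
      by (intro prob_space_imp_sigma_finite prob_space_return) simp
    show "AE s in return borel t. 0 \<le> s \<and> s \<le> 1"
      using t by (subst AE_return) auto
    fix x y C' assume *: "x \<in> X" "y \<in> Y" and C'[measurable]: "C' \<in> sets borel" and "C \<subseteq> C'"
    have "{s. (1 - s) *\<^sub>R x + s *\<^sub>R y \<in> C'} \<in> sets borel"
      by measurable
    then show "1 \<le> emeasure (return borel t) {s. (1 - s) *\<^sub>R x + s *\<^sub>R y \<in> C'}"
      using hyp[OF *] \<open>C \<subseteq> C'\<close> by (auto simp: indicator_def)
  qed simp
  also have "\<dots> = ennreal (vol C * (vol X powr (t - 1) * vol Y powr (- t)))"
    by (subst nn_integral_return) (auto simp: ennreal_mult vol_def)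
  finally have "1 \<le> vol C * (vol X powr (t - 1) * vol Y powr (- t))"
    by simp
  then show ?thesis
    using pos by (simp add: powr_diff powr_minus field_simps)
qed

text \<open>The case of Lebesgue measure on \<open>{0..1}\<close>. For different volumes the
  integral on the right is the logarithmic mean of \<open>1 / vol X\<close> and
  \<open>1 / vol Y\<close>.\<close>

lemma interpolation_integral_bound:
  fixes X Y C :: "'a::euclidean_space set"
  assumes meas: "X \<in> lmeasurable" "Y \<in> lmeasurable" "C \<in> lmeasurable"
    and pos: "0 < vol X" "0 < vol Y"
    and hyp: "\<And>x y C'. x \<in> X \<Longrightarrow> y \<in> Y \<Longrightarrow> C' \<in> sets borel \<Longrightarrow> C \<subseteq> C' \<Longrightarrow>
      ennreal \<theta> \<le> emeasure lborel {s \<in> {0..1}. (1 - s) *\<^sub>R x + s *\<^sub>R y \<in> C'}"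
  shows "ennreal \<theta> \<le> ennreal (vol C)
    * (\<integral>\<^sup>+s. ennreal (vol X powr (s - 1) * vol Y powr (- s)) * indicator {0..1} s \<partial>lborel)"
proof -
  let ?\<sigma> = "density lborel (indicator {0..1::real})"
  have "ennreal \<theta> \<le> ennreal (vol C) * (\<integral>\<^sup>+s. ennreal (vol X powr (s - 1) * vol Y powr (- s)) \<partial>?\<sigma>)"
  proof (rule interpolation_inequality_vol[OF _ _ _ meas pos])
    have "prob_space ?\<sigma>"
      by (rule prob_spaceI) (simp add: emeasure_density)
    then show "sigma_finite_measure ?\<sigma>"
      by (rule prob_space_imp_sigma_finite)
    show "AE s in ?\<sigma>. 0 \<le> s \<and> s \<le> 1"
      by (subst AE_density) (auto simp: indicator_def)
    fix x y C' assume *: "x \<in> X" "y \<in> Y" and C'[measurable]: "C' \<in> sets borel" and "C \<subseteq> C'"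
    have [measurable]: "{s. (1 - s) *\<^sub>R x + s *\<^sub>R y \<in> C'} \<in> sets borel"
      by measurable
    have "ennreal \<theta> \<le> emeasure lborel {s \<in> {0..1}. (1 - s) *\<^sub>R x + s *\<^sub>R y \<in> C'}"
      using * C' \<open>C \<subseteq> C'\<close> by (rule hyp)
    also have "{s \<in> {0..1}. (1 - s) *\<^sub>R x + s *\<^sub>R y \<in> C'} = {0..1} \<inter> {s. (1 - s) *\<^sub>R x + s *\<^sub>R y \<in> C'}"
      by auto
    also have "emeasure lborel \<dots> = emeasure ?\<sigma> {s. (1 - s) *\<^sub>R x + s *\<^sub>R y \<in> C'}"
      by (subst emeasure_density) (auto simp: indicator_inter_arith[symmetric])
    finally show "ennreal \<theta> \<le> emeasure ?\<sigma> {s. (1 - s) *\<^sub>R x + s *\<^sub>R y \<in> C'}" .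
  qed simp
  then show ?thesis
    by (subst (asm) nn_integral_density) (auto simp: mult.commute)
qed

section \<open>Separated sets\<close>

text \<open>After the last time in \<open>A\<close> and before the first later time in
  \<open>B\<close> the segment is in \<open>C\<close>; meanwhile it covers a distance of at least
  \<open>d\<close> at speed at most \<open>D\<close>.\<close>

lemma segment_crossing_time:
  fixes A B C :: "'a::euclidean_space set"
  assumes x: "x \<in> A" and y: "y \<in> B" and seg: "closed_segment x y \<subseteq> A \<union> C \<union> B"
    and sep: "\<And>a b. a \<in> A \<Longrightarrow> b \<in> B \<Longrightarrow> d \<le> norm (a - b)"
    and D: "0 < D" "norm (x - y) \<le> D"
    and [measurable]: "C' \<in> sets borel" and "C \<subseteq> C'"
  shows "ennreal (d / D) \<le> emeasure lborel {s \<in> {0..1}. (1 - s) *\<^sub>R x + s *\<^sub>R y \<in> C'}"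
proof -
  define \<gamma> where "\<gamma> s = (1 - s) *\<^sub>R x + s *\<^sub>R y" for s
  have \<gamma>_mem: "\<gamma> s \<in> A \<union> C \<union> B" if "s \<in> {0..1}" for s
    using that seg by (auto simp: \<gamma>_def closed_segment_def)
  define P where "P = {s \<in> {0..1}. \<gamma> s \<in> A}"
  define s0 where "s0 = Sup P"
  have P: "0 \<in> P" "bdd_above P"
    using x by (auto simp: P_def \<gamma>_def intro!: bdd_aboveI[of _ 1])
  have s0: "0 \<le> s0" "s0 \<le> 1"
    using P unfolding s0_def by (auto intro!: cSup_upper cSup_least simp: P_def)
  define Q where "Q = {s \<in> {s0..1}. \<gamma> s \<in> B}"
  define s1 where "s1 = Inf Q"
  have Q: "1 \<in> Q" "bdd_below Q"
    using y s0 by (auto simp: Q_def \<gamma>_def intro!: bdd_belowI[of _ s0])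
  have s1: "s1 \<le> 1"
    using Q unfolding s1_def by (auto intro!: cInf_lower)
  \<comment> \<open>\<open>Sup P\<close> and \<open>Inf Q\<close> need not be attained, so the
    distance is estimated for all pairs of times before passing to the bounds.\<close>
  have step: "p + d / D \<le> q" if "p \<in> P" "q \<in> Q" for p q
  proof -
    have "p \<le> s0"
      using P that by (auto simp: s0_def intro: cSup_upper)
    then have pq: "p \<le> q"
      using that by (auto simp: Q_def)
    have "d \<le> norm (\<gamma> p - \<gamma> q)"
      using that by (intro sep) (auto simp: P_def Q_def)
    also have "\<gamma> p - \<gamma> q = (q - p) *\<^sub>R (x - y)"
      by (simp add: \<gamma>_def algebra_simps)
    also have "norm \<dots> \<le> (q - p) * D"
      using pq D by (simp add: mult_left_mono)
    finally show ?thesis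
      using D by (simp add: field_simps)
  qed
  have "p + d / D \<le> s1" if "p \<in> P" for p
    unfolding s1_def using Q step[OF that] by (intro cInf_greatest) auto
  then have "s0 \<le> s1 - d / D"
    unfolding s0_def using P by (intro cSup_least) (auto simp: algebra_simps)
  then have "ennreal (d / D) \<le> ennreal (s1 - s0)"
    by (intro ennreal_leI) simp
  also have "\<dots> \<le> emeasure lborel {s0<..<s1}"
    by (cases "s0 \<le> s1") (auto simp: ennreal_neg)
  also have "\<dots> \<le> emeasure lborel {s \<in> {0..1}. \<gamma> s \<in> C'}"
  proof (rule emeasure_mono)
    have [measurable]: "\<gamma> \<in> borel_measurable borel"
      unfolding \<gamma>_def by measurable
    show "{s \<in> {0..1}. \<gamma> s \<in> C'} \<in> sets lborel"
      by measurable
    show "{s0<..<s1} \<subseteq> {s \<in> {0..1}. \<gamma> s \<in> C'}"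
    proof
      fix s assume s: "s \<in> {s0<..<s1}"
      then have s01: "s \<in> {0..1}"
        using s0 s1 by auto
      have "s \<notin> P"
        using s cSup_upper[OF _ P(2), of s] by (auto simp: s0_def)
      moreover have "s \<notin> Q"
        using s cInf_lower[OF _ Q(2), of s] by (auto simp: s1_def)
      ultimately show "s \<in> {s \<in> {0..1}. \<gamma> s \<in> C'}"
        using \<gamma>_mem[OF s01] s s01 \<open>C \<subseteq> C'\<close> by (auto simp: P_def Q_def)
    qed
  qed
  finally show ?thesis
    by (simp add: \<gamma>_def)
qed

text \<open>The crossing time is fed into the integral bound and the integral is estimated in two
  ways. The logarithmic form gains a factor \<open>ln (vol X / vol Y)\<close>, which matters when
  \<open>Y\<close> is tiny.\<close>

lemma separating_vol_ge:
  fixes A B C X Y :: "'a::euclidean_space set"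
  assumes meas: "X \<in> lmeasurable" "Y \<in> lmeasurable" "C \<in> lmeasurable"
    and pos: "0 < vol X" "0 < vol Y"
    and XY: "X \<subseteq> A" "Y \<subseteq> B"
    and seg: "\<And>x y. x \<in> X \<Longrightarrow> y \<in> Y \<Longrightarrow> closed_segment x y \<subseteq> A \<union> C \<union> B"
    and sep: "\<And>a b. a \<in> A \<Longrightarrow> b \<in> B \<Longrightarrow> d \<le> norm (a - b)"
    and D: "0 < D" "\<And>x y. x \<in> X \<Longrightarrow> y \<in> Y \<Longrightarrow> norm (x - y) \<le> D" and d: "0 \<le> d"
  shows separating_vol_ge_min: "d / D * min (vol X) (vol Y) \<le> vol C"
    and separating_vol_ge_ln: "vol Y < vol X \<Longrightarrow> d / D * (vol Y * ln (vol X / vol Y)) \<le> vol C"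
proof -
  define I where "I = (\<integral>\<^sup>+s. ennreal (vol X powr (s - 1) * vol Y powr (- s)) * indicator {0..1} s \<partial>lborel)"
  have main: "ennreal (d / D) \<le> ennreal (vol C) * I"
    unfolding I_def using XY D
    by (intro interpolation_integral_bound[OF meas pos] segment_crossing_time[where A = A and B = B and C = C])
       (auto intro: seg sep dest: seg[THEN subsetD])
  have C: "0 \<le> vol C"
    by (simp add: vol_def)
  have concl: "d / D * r \<le> vol C" if "I \<le> ennreal (1 / r)" "0 < r" for r
  proof -
    have "ennreal (d / D) \<le> ennreal (vol C) * ennreal (1 / r)"
      using main that(1) by (meson mult_left_mono order_trans zero_le)
    also have "\<dots> = ennreal (vol C * (1 / r))"
      using C that by (simp add: ennreal_mult[symmetric])
    finally have "d / D \<le> vol C * (1 / r)"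
      using C that by (subst (asm) ennreal_le_iff) auto
    then show ?thesis
      using that(2) by (simp add: field_simps)
  qed
  show "d / D * min (vol X) (vol Y) \<le> vol C"
  proof (rule concl)
    let ?m = "min (vol X) (vol Y)"
    have m: "0 < ?m"
      using pos by auto
    have "I \<le> (\<integral>\<^sup>+s. ennreal (1 / ?m) * indicator {0..1::real} s \<partial>lborel)"
      unfolding I_def
    proof (rule nn_integral_mono)
      fix s :: real
      have "vol X powr (s - 1) * vol Y powr (- s) \<le> 1 / ?m" if s: "0 \<le> s" "s \<le> 1"
      proof -
        \<comment> \<open>Both exponents are nonpositive, so replacing a volume by the minimum
          increases its power.\<close>
        have "vol X powr (s - 1) * vol Y powr (- s) \<le> ?m powr (s - 1) * ?m powr (- s)"
          using m s by (intro mult_mono powr_mono2') auto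
        also have "\<dots> = ?m powr (- 1)"
          by (simp only: powr_add[symmetric]) simp
        also have "\<dots> = 1 / ?m"
          using m by (simp add: powr_minus_divide del: min_less_iff_conj)
        finally show ?thesis .
      qed
      then show "ennreal (vol X powr (s - 1) * vol Y powr (- s)) * indicator {0..1} s
          \<le> ennreal (1 / ?m) * indicator {0..1} s"
        by (auto simp: indicator_def intro!: ennreal_leI)
    qed
    also have "\<dots> = ennreal (1 / ?m)"
      by (simp add: nn_integral_cmult)
    finally show "I \<le> ennreal (1 / ?m)" .
  qed (use pos in auto)
  show "d / D * (vol Y * ln (vol X / vol Y)) \<le> vol C" if lt: "vol Y < vol X"
  proof (rule concl)
    define l where "l = ln (vol X / vol Y)"
    have l: "0 < l"
      using lt pos by (simp add: l_def)
    then show "0 < vol Y * ln (vol X / vol Y)"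
      using pos by (simp add: l_def)
    let ?f = "\<lambda>s. vol X powr (s - 1) * vol Y powr (- s)"
    \<comment> \<open>The derivative of \<open>?f\<close> is \<open>l * ?f\<close>. The subtracted
      term \<open>?f 0 / l = 1 / (vol X * l)\<close> is dropped afterwards.\<close>
    have "I = ennreal (?f 1 / l - ?f 0 / l)"
      unfolding I_def
    proof (rule nn_integral_FTC_Icc[where F = "\<lambda>s. ?f s / l"])
      fix s :: real
      have "(?f has_real_derivative ?f s * l) (at s)"
        using pos by (auto intro!: derivative_eq_intros simp: l_def ln_div algebra_simps)
      from DERIV_cdivide[OF this, of l]
      show "((\<lambda>s. ?f s / l) has_real_derivative ?f s) (at s)"
        using l by simp
    qed (use pos in auto)
    also have "\<dots> \<le> ennreal (1 / (vol Y * ln (vol X / vol Y)))"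
      using pos l lt by (intro ennreal_leI) (simp add: l_def[symmetric] powr_minus_divide field_simps)
    finally show "I \<le> ennreal (1 / (vol Y * ln (vol X / vol Y)))" .
  qed
qed

section \<open>Star-shaped bodies\<close>

text \<open>The kernel is \<open>S\<close> intersected with preimages of the closed set
  \<open>S\<close> under affine maps.\<close>

lemma compact_kernel:
  fixes S :: "'a::euclidean_space set"
  assumes "compact S"
  shows "compact (kernel S)"
proof -
  have "kernel S = S \<inter> (\<Inter>y\<in>S. \<Inter>t\<in>{0..1}. (\<lambda>x. (1 - t) *\<^sub>R x + t *\<^sub>R y) -` S)"
    unfolding kernel_def closed_segment_def by auto blast
  also have "compact \<dots>"
    using assms
    by (intro compact_Int_closed closed_INT ballI closed_vimage continuous_intros compact_imp_closed)
  finally show ?thesis .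
qed

text \<open>Chebyshev's inequality for the uniform distribution on \<open>S\<close>, about an
  arbitrary point \<open>z\<close>.\<close>

lemma vol_far_le:
  fixes S :: "'a::euclidean_space set"
  assumes S: "compact S" and L: "0 < L"
  shows "vol {x \<in> S. L \<le> norm (x - z)} \<le> integral S (\<lambda>x. (norm (x - z))\<^sup>2) / L\<^sup>2"
proof -
  let ?T = "{x \<in> S. L \<le> norm (x - z)}"
  have "?T = S \<inter> {x. L \<le> norm (x - z)}"
    by auto
  then have T: "compact ?T"
    using S by (simp add: compact_Int_closed closed_Collect_le continuous_intros)
  have int: "(\<lambda>x. (norm (x - z))\<^sup>2) integrable_on K" if "compact K" for K
  proof -
    have "set_integrable lborel K (\<lambda>x. (norm (x - z))\<^sup>2)"
      unfolding set_integrable_def using that by (intro borel_integrable_compact continuous_intros)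
    then show ?thesis
      by (rule set_borel_integral_eq_integral)
  qed
  have one: "((\<lambda>x. 1) has_integral vol ?T) ?T"
    using lmeasurable_compact[OF T]
    by (simp add: vol_def lmeasure_integral integrable_integral lmeasurable_iff_integrable_on)
  have "L\<^sup>2 * vol ?T \<le> integral ?T (\<lambda>x. (norm (x - z))\<^sup>2)"
    using has_integral_mult_right[OF one, of "L\<^sup>2"] L
    by (intro has_integral_le[OF _ integrable_integral[OF int[OF T]]]) (auto intro: power_mono)
  also have "\<dots> \<le> integral S (\<lambda>x. (norm (x - z))\<^sup>2)"
    using int[OF T] int[OF S] by (intro integral_subset_le) auto
  finally show ?thesis
    using L by (simp add: field_simps)
qed

lemma vol_le_add:
  fixes A B C :: "'a::euclidean_space set"
  assumes "A \<subseteq> B \<union> C" "A \<in> lmeasurable" "B \<in> lmeasurable" "C \<in> lmeasurable"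
  shows "vol A \<le> vol B + vol C"
proof -
  have "measure lebesgue A \<le> measure lebesgue (B \<union> C)"
    using assms by (intro measure_mono_fmeasurable) auto
  also have "\<dots> \<le> measure lebesgue B + measure lebesgue C"
    using assms by (intro measure_Un_le) auto
  finally show ?thesis
    by (simp add: vol_def)
qed

lemma vol_kernel_near_ge:
  fixes S :: "'a::euclidean_space set"
  assumes S: "compact S"
  shows "vol (kernel S) \<le> vol (kernel S \<inter> cball z (2 * R)) + vol {x \<in> S. 2 * R \<le> norm (x - z)}"
proof (rule vol_le_add)
  have "{x \<in> S. 2 * R \<le> norm (x - z)} = S \<inter> {x. 2 * R \<le> norm (x - z)}"
    by auto
  then show "{x \<in> S. 2 * R \<le> norm (x - z)} \<in> lmeasurable"
    using S by (simp add: lmeasurable_compact compact_Int_closed closed_Collect_le continuous_intros)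
  show "kernel S \<in> lmeasurable" "kernel S \<inter> cball z (2 * R) \<in> lmeasurable"
    using compact_kernel[OF S] by (auto intro!: lmeasurable_compact compact_Int_closed)
qed (auto simp: kernel_def dist_norm norm_minus_commute)

text \<open>Borell's argument: interpolating between the kernel and the far part of \<open>S\<close> shows that the
  tail of \<open>S\<close> decays exponentially on the scale \<open>R\<close>, with no loss in \<open>\<eta>\<close>.\<close>

lemma star_shaped_tail:
  fixes S :: "'a::euclidean_space set"
  assumes S: "compact S" and R: "0 < R" and H: "0 < H" and b: "0 < b" "b < H / 16"
    and K: "3 / 4 * H \<le> vol (kernel S \<inter> cball z (2 * R))" "vol (kernel S \<inter> cball z (2 * R)) \<le> H"
    and far: "vol {x \<in> S. 4 * R \<le> norm (x - z)} \<le> H / 16"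
  shows "vol {x \<in> S. (3 * ln (2 * H / b) - 2) * R \<le> norm (x - z)} \<le> b / 2"
proof (rule ccontr)
  define u where "u = ln (2 * H / b)"
  \<comment> \<open>Since \<open>t * u = 2\<close>, a point within \<open>2 * R\<close> of
    \<open>z\<close> and one beyond \<open>?L\<close> interpolate to one beyond
    \<open>t * ?L - (1 - t) * (2 * R) = 4 * R\<close>; moreover
    \<open>exp (- u) powr t = exp (- 2)\<close>.\<close>
  define t where "t = 2 / u"
  define \<kappa> where "\<kappa> = vol (kernel S \<inter> cball z (2 * R))"
  let ?far = "\<lambda>L. {x \<in> S. L \<le> norm (x - z)}"
  let ?L = "(3 * u - 2) * R"
  assume "\<not> vol {x \<in> S. (3 * ln (2 * H / b) - 2) * R \<le> norm (x - z)} \<le> b / 2"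
  then have T: "b / 2 < vol (?far ?L)"
    by (simp add: u_def)
  have far_eq: "?far L = S \<inter> {x. L \<le> norm (x - z)}" for L
    by auto
  have far_meas: "?far L \<in> lmeasurable" for L
    unfolding far_eq using S
    by (intro lmeasurable_compact compact_Int_closed closed_Collect_le continuous_intros)
  have "exp 2 \<le> (9::real)"
    using power_mono[OF exp_le, of 2] by (simp add: exp_of_nat_mult[symmetric])
  also have "\<dots> \<le> 2 * H / b"
    using b by (simp add: field_simps)
  finally have u: "2 \<le> u"
    unfolding u_def using b H by (subst ln_ge_iff) auto
  then have t: "0 < t" "t \<le> 1"
    by (auto simp: t_def)
  have "\<kappa> powr (1 - t) * vol (?far ?L) powr t \<le> vol (?far (4 * R))"
    unfolding \<kappa>_def
  proof (rule vol_interpolation_ge)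
    show "kernel S \<inter> cball z (2 * R) \<in> lmeasurable"
      using compact_kernel[OF S] by (intro lmeasurable_compact compact_Int_closed) auto
    show "?far ?L \<in> lmeasurable" "?far (4 * R) \<in> lmeasurable"
      by (rule far_meas)+
    fix x y assume x: "x \<in> kernel S \<inter> cball z (2 * R)" and y: "y \<in> ?far ?L"
    have "(1 - t) *\<^sub>R x + t *\<^sub>R y \<in> closed_segment x y"
      using t by (auto simp: closed_segment_def)
    then have "(1 - t) *\<^sub>R x + t *\<^sub>R y \<in> S"
      using x y by (auto simp: kernel_def)
    moreover have "4 * R \<le> norm ((1 - t) *\<^sub>R x + t *\<^sub>R y - z)"
    proof -
      have "4 * R = t * ?L - (1 - t) * (2 * R)"
        using u by (simp add: t_def field_simps)
      also have "\<dots> \<le> t * norm (y - z) - (1 - t) * norm (x - z)"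
        using x y t by (intro diff_mono mult_left_mono) (auto simp: dist_norm norm_minus_commute)
      also have "\<dots> = norm (t *\<^sub>R (y - z)) - norm ((1 - t) *\<^sub>R (x - z))"
        using t by simp
      also have "\<dots> \<le> norm (t *\<^sub>R (y - z) + (1 - t) *\<^sub>R (x - z))"
        by (rule norm_diff_ineq)
      also have "t *\<^sub>R (y - z) + (1 - t) *\<^sub>R (x - z) = (1 - t) *\<^sub>R x + t *\<^sub>R y - z"
        by (simp add: algebra_simps)
      finally show ?thesis .
    qed
    ultimately show "(1 - t) *\<^sub>R x + t *\<^sub>R y \<in> ?far (4 * R)"
      by simp
  qed (use K H T b t in auto)
  also have "\<dots> \<le> H / 16"
    by (rule far)
  finally have "\<kappa> powr (1 - t) * vol (?far ?L) powr t \<le> H / 16" .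
  moreover have "\<kappa> * exp (- 2) < \<kappa> powr (1 - t) * vol (?far ?L) powr t"
  proof -
    have \<kappa>: "0 < \<kappa>" "\<kappa> \<le> H"
      using K H by (auto simp: \<kappa>_def)
    have "exp (- 2) = exp (- u) powr t"
      using u by (simp add: t_def powr_def)
    also have "exp (- u) = b / (2 * H)"
      using b H by (simp add: u_def exp_minus)
    also have "(b / (2 * H)) powr t < (vol (?far ?L) / \<kappa>) powr t"
    proof (rule powr_less_mono2)
      have "b / (2 * H) \<le> b / 2 / \<kappa>"
        using \<kappa> b by (simp add: field_simps)
      also have "\<dots> < vol (?far ?L) / \<kappa>"
        using T \<kappa> by (intro divide_strict_right_mono)
      finally show "b / (2 * H) < vol (?far ?L) / \<kappa>" .
    qed (use t b H in auto)
    finally have "\<kappa> * exp (- 2) < \<kappa> * (vol (?far ?L) / \<kappa>) powr t"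
      using \<kappa> by simp
    also have "\<dots> = \<kappa> powr (1 - t) * vol (?far ?L) powr t"
      using \<kappa> T b by (simp add: powr_divide powr_diff)
    finally show ?thesis .
  qed
  \<comment> \<open>With \<open>exp 2 \<le> 9\<close> the right side is at least
    \<open>H / 12\<close>, so a far part larger than \<open>b / 2\<close> would contradict
    \<open>far\<close>.\<close>
  moreover have "H / 16 \<le> \<kappa> * exp (- 2)"
  proof -
    have "H / 16 \<le> (3 / 4 * H) * (1 / 9)"
      using H by simp
    also have "\<dots> \<le> \<kappa> * exp (- 2)"
      using K H \<open>exp 2 \<le> 9\<close> unfolding \<kappa>_def exp_minus inverse_eq_divide
      by (intro mult_mono divide_left_mono) auto
    finally show ?thesis .
  qed
  ultimately show False
    by linarith
qed

section \<open>The separation bound and the final choice of sides\<close>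

text \<open>The kernel points in \<open>A\<close> near \<open>z\<close> see every point of
  \<open>B\<close> within \<open>S\<close>. Truncating \<open>B\<close> to a ball bounds the
  distances, and the radius depends on how \<open>vol B\<close> compares with the volume of the
  kernel.\<close>

lemma star_shaped_separation_one_sided:
  fixes S A B C :: "'a::euclidean_space set"
  assumes S: "compact S" and R: "0 < R" and \<eta>: "\<eta> = eta S" "0 < \<eta>"
    and far: "\<And>L. 0 < L \<Longrightarrow> vol {x \<in> S. L \<le> norm (x - z)} \<le> \<eta> * vol S * (R / L)\<^sup>2"
    and meas: "A \<in> sets lebesgue" "B \<in> sets lebesgue" "C \<in> sets lebesgue"
    and part: "A \<inter> B = {}" "A \<union> C \<union> B = S"
    and sep: "\<And>a b. a \<in> A \<Longrightarrow> b \<in> B \<Longrightarrow> d \<le> norm (a - b)" and d: "0 \<le> d"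
    and X: "\<eta> * vol S / 4 \<le> vol (A \<inter> (kernel S \<inter> cball z (2 * R)))"
  shows "\<eta> * d / (16 * R) * min (vol A) (vol B) \<le> vol C"
proof -
  let ?far = "\<lambda>L. {x \<in> S. L \<le> norm (x - z)}"
  let ?K = "kernel S \<inter> cball z (2 * R)"
  let ?X = "A \<inter> ?K"
  define V where "V = vol S"
  define m where "m = min (vol A) (vol B)"
  define b where "b = vol B"
  have lm: "T \<in> lmeasurable" if "T \<subseteq> S" "T \<in> sets lebesgue" for T
    using that S by (meson bounded_set_imp_lmeasurable bounded_subset compact_imp_bounded)
  have far_eq: "?far L = S \<inter> {x. L \<le> norm (x - z)}" for L
    by auto
  have far_meas: "?far L \<in> lmeasurable" for L
    unfolding far_eq using S
    by (intro lmeasurable_compact compact_Int_closed closed_Collect_le continuous_intros)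
  have K_sub: "kernel S \<subseteq> S"
    by (auto simp: kernel_def)
  have ker: "kernel S \<in> lmeasurable" and K: "?K \<in> lmeasurable"
    using compact_kernel[OF S] by (auto intro!: lmeasurable_compact compact_Int_closed)
  have abc: "A \<in> lmeasurable" "B \<in> lmeasurable" "C \<in> lmeasurable" "S \<in> lmeasurable"
    using lm[of A] lm[of B] lm[of C] meas part S by (auto simp: lmeasurable_compact)
  have Xm: "?X \<in> lmeasurable"
    using K abc by blast
  \<comment> \<open>Division by zero gives \<open>0\<close>, so \<open>0 < \<eta>\<close> forces a
    nonzero volume.\<close>
  have V: "0 < V"
    using \<eta> unfolding eta_def V_def by (metis divide_eq_0_iff less_irrefl measure_nonneg order_le_less vol_def)
  have kV: "vol (kernel S) = \<eta> * V"
    using V \<eta> by (simp add: eta_def V_def)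
  have \<eta>1: "\<eta> \<le> 1"
  proof -
    have "vol (kernel S) \<le> vol S"
      unfolding vol_def using K_sub ker abc by (intro measure_mono_fmeasurable) auto
    then show ?thesis
      using kV V by (simp add: V_def)
  qed
  define H where "H = \<eta> * V"
  have H: "0 < H" "H \<le> V"
    using \<eta> V \<eta>1 by (auto simp: H_def)
  have far': "vol (?far (k * R)) \<le> H / k\<^sup>2" if "0 < k" for k
    using far[of "k * R"] R that by (simp add: H_def V_def power_divide)
  have mV: "m \<le> V / 2"
  proof -
    have "vol A + vol B = vol (A \<union> B)"
      unfolding vol_def using abc part by (simp add: measure_Un_AE measure_Un2 Diff_triv Int_commute)
    also have "\<dots> \<le> V"
      unfolding vol_def V_def using abc part by (intro measure_mono_fmeasurable) auto
    finally show ?thesis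
      by (auto simp: m_def)
  qed
  have m: "0 \<le> m" "m \<le> b"
    by (auto simp: m_def b_def vol_def)
  have seg: "closed_segment x y \<subseteq> A \<union> C \<union> B" if "x \<in> ?X" "y \<in> B" for x y
    using that part by (auto simp: kernel_def)
  have goal: "\<eta> * d / (16 * R) * m \<le> vol C"
  proof (cases "m = 0")
    case True
    then show ?thesis by (simp add: vol_def)
  next
    case False
    then have b: "0 < b"
      using m by auto
    have near: "b - vol (?far L) \<le> vol (B \<inter> ball z L)" "B \<inter> ball z L \<in> lmeasurable"
      "vol (B \<inter> ball z L) \<le> b" for L
    proof -
      show Bm: "B \<inter> ball z L \<in> lmeasurable"
        using abc by (simp add: fmeasurable_Int_fmeasurable)
      have "vol B \<le> vol (B \<inter> ball z L) + vol (?far L)"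
        using part abc Bm far_meas by (intro vol_le_add) (auto simp: dist_norm norm_minus_commute)
      then show "b - vol (?far L) \<le> vol (B \<inter> ball z L)"
        by (simp add: b_def)
      show "vol (B \<inter> ball z L) \<le> b"
        unfolding vol_def b_def using abc Bm by (intro measure_mono_fmeasurable) auto
    qed
    have dist: "norm (x - y) \<le> 2 * R + L" if "x \<in> ?X" "y \<in> B \<inter> ball z L" for x y L
      using that norm_triangle_ineq4[of "x - z" "y - z"] by (auto simp: dist_norm norm_minus_commute)
    have Xpos: "0 < vol ?X"
      using X H by (simp add: H_def V_def)
    show ?thesis
    proof (cases "H / 16 \<le> b")
      \<comment> \<open>Chebyshev at radius \<open>6 * R\<close> removes at most
        \<open>H / 36\<close>, less than half of \<open>b\<close> when
        \<open>H / 16 \<le> b\<close>. All distances are then at most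
        \<open>2 * R + 6 * R = 8 * R\<close>.\<close>
      case True
      let ?Y = "B \<inter> ball z (6 * R)"
      have "b / 2 \<le> b - H / 36"
        using True b by simp
      also have "\<dots> \<le> vol ?Y"
        using near(1)[of "6 * R"] far'[of 6] by simp
      finally have Y: "b / 2 \<le> vol ?Y" .
      \<comment> \<open>On the side of \<open>X\<close> this uses \<open>m \<le> V / 2\<close>; on
        the side of \<open>?Y\<close> it uses \<open>\<eta> \<le> 1\<close>. With
        \<open>8 * R\<close> it yields the constant 16.\<close>
      have "\<eta> * m / 2 \<le> min (vol ?X) (vol ?Y)"
      proof -
        have "\<eta> * m / 2 \<le> \<eta> * (V / 2) / 2"
          using mV \<eta> by simp
        also have "\<dots> \<le> vol ?X"
          using X by (simp add: V_def)
        finally have "\<eta> * m / 2 \<le> vol ?X" .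
        moreover have "\<eta> * m \<le> 1 * b"
          using \<eta> \<eta>1 m by (intro mult_mono) auto
        ultimately show ?thesis
          using Y by auto
      qed
      then have "d / (8 * R) * (\<eta> * m / 2) \<le> d / (8 * R) * min (vol ?X) (vol ?Y)"
        using d R by (intro mult_left_mono) auto
      also have "\<dots> \<le> vol C"
      proof (rule separating_vol_ge_min[where A = A and B = B])
        show "norm (x - y) \<le> 8 * R" if "x \<in> ?X" "y \<in> ?Y" for x y
          using dist[OF that] by simp
      qed (use Xm near abc Xpos Y b R d sep seg in auto)
      finally show ?thesis
        by (simp add: field_simps)
    next
      case False
      \<comment> \<open>For small \<open>b\<close> the tail lemma keeps half of \<open>B\<close>
        within \<open>?L\<close>, and distances are at most \<open>2 * R + ?L = 3 * u * R\<close>.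
        The logarithm of the volume ratio has to pay for this factor \<open>u\<close>.\<close>
      define u where "u = ln (2 * H / b)"
      let ?L = "(3 * u - 2) * R"
      let ?Y = "B \<inter> ball z ?L"
      have K1: "3 / 4 * H \<le> vol ?K"
        using vol_kernel_near_ge[OF S, of z R] kV far'[of 2] by (simp add: H_def)
      have K2: "vol ?K \<le> H"
        unfolding H_def kV[symmetric] vol_def using K ker by (intro measure_mono_fmeasurable) auto
      have "vol (?far ?L) \<le> b / 2"
        unfolding u_def using False b K1 K2 H R S far'[of 4] by (intro star_shaped_tail) auto
      then have Y: "b / 2 \<le> vol ?Y"
        using near(1)[of ?L] by simp
      have "ln 32 \<le> u"
        unfolding u_def using False b by (simp add: field_simps)
      moreover have "ln (32::real) = 5 * ln 2"
        using ln_realpow[of 2 5] by simp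
      ultimately have u: "5 * ln 2 \<le> u"
        by simp
      then have u0: "2 < u"
        using ln2_ge_two_thirds by linarith
      have ln8: "ln (8::real) = 3 * ln 2"
        using ln_realpow[of 2 3] by simp
      \<comment> \<open>The ratio is at least \<open>(H / 4) / b\<close>, one eighth of
        \<open>exp u = 2 * H / b\<close>.\<close>
      have lnX: "u - 3 * ln 2 \<le> ln (vol ?X / vol ?Y)"
      proof -
        have "u - 3 * ln 2 = ln (H / (4 * b))"
          unfolding u_def ln8[symmetric] using H b by (simp add: ln_div ln_mult flip: ln8) 
            (use ln_mult[of 2 4] in simp)
        also have "\<dots> \<le> ln (vol ?X / vol ?Y)"
        proof (rule ln_mono)
          have "H / (4 * b) = (H / 4) / b"
            by simp
          also have "\<dots> \<le> vol ?X / vol ?Y"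
            using X Y b H near(3) by (intro frac_le) (auto simp: H_def V_def)
          finally show "H / (4 * b) \<le> vol ?X / vol ?Y" .
        qed (use H b in auto)
        finally show ?thesis .
      qed
      have "\<eta> * d / (16 * R) * m \<le> 1 * d / (16 * R) * b"
        using \<eta> \<eta>1 d R m by (intro mult_mono divide_right_mono) auto
      also have "\<dots> = d * b / R * (1 / 16)"
        by simp
      \<comment> \<open>This amounts to \<open>48 * ln 2 \<le> 10 * u\<close>, which follows from
        \<open>5 * ln 2 \<le> u\<close>, that is from \<open>b < H / 16\<close>.\<close>
      also have "\<dots> \<le> d * b / R * ((u - 3 * ln 2) / (6 * u))"
        using d b R u u0 by (intro mult_left_mono) (auto simp: field_simps)
      also have "\<dots> = d / (3 * u * R) * (b / 2 * (u - 3 * ln 2))"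
        using u0 R by (simp add: field_simps)
      also have "\<dots> \<le> d / (3 * u * R) * (vol ?Y * ln (vol ?X / vol ?Y))"
        using d u0 R Y lnX u b ln2_ge_two_thirds by (intro mult_left_mono mult_mono) auto
      also have "\<dots> \<le> vol C"
      proof (rule separating_vol_ge_ln[where A = A and B = B])
        show "vol ?Y < vol ?X"
          using near(3)[of ?L] X False b by (simp add: H_def V_def)
        show "norm (x - y) \<le> 3 * u * R" if "x \<in> ?X" "y \<in> ?Y" for x y
          using dist[OF that] by (simp add: algebra_simps)
      qed (use Xm near abc Xpos Y b R d u0 sep seg in auto)
      finally show ?thesis .
    qed
  qed
  then show ?thesis
    by (simp add: m_def)
qed

theorem theorem1p2:
  fixes S S1 S2 S3 :: "'a::euclidean_space set"
  assumes "star_shaped_body S"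
    and "eta S > 0"
    and "S1 \<in> sets lebesgue" and "S2 \<in> sets lebesgue" and "S3 \<in> sets lebesgue"
    and "S1 \<inter> S2 = {}" and "S1 \<inter> S3 = {}" and "S2 \<inter> S3 = {}"
    and "S1 \<union> S3 \<union> S2 = S"
  shows "vol S3 \<ge> eta S / 4 * vol S
    \<or> vol S3 \<ge> eta S powr (3/2) / (16 * sqrt (second_moment S))
                * set_dist S1 S2 * min (vol S1) (vol S2)"
proof (cases "eta S / 4 * vol S \<le> vol S3 \<or> second_moment S \<le> 0 \<or> S1 = {} \<or> S2 = {}")
  \<comment> \<open>In the degenerate cases the second alternative has right side \<open>0\<close>:
    either the second moment vanishes and division by \<open>sqrt 0\<close> gives \<open>0\<close>,
    or the minimum of the volumes is \<open>0\<close>.\<close>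
  case True
  have "second_moment S \<ge> 0"
    unfolding second_moment_def vol_def
    by (cases "(\<lambda>x. (norm (x - centroid S))\<^sup>2) integrable_on S")
       (auto intro!: divide_nonneg_nonneg integral_nonneg simp: not_integrable_integral)
  then show ?thesis
    using True by (auto simp: vol_def)
next
  case False
  define \<eta> M d z where "\<eta> = eta S" and "M = second_moment S" and "d = set_dist S1 S2"
    and "z = centroid S"
  \<comment> \<open>At this scale Chebyshev's bound becomes
    \<open>\<eta> * vol S * (R / L)\<^sup>2\<close>, so the part beyond \<open>2 * R\<close> has at
    most a quarter of the kernel's volume.\<close>
  define R where "R = sqrt (M / \<eta>)"
  have pos: "0 < \<eta>" "0 < M"
    using assms(2) False by (auto simp: \<eta>_def M_def)
  then have R: "0 < R" "R\<^sup>2 = M / \<eta>"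
    by (auto simp: R_def)
  have S: "compact S"
    using assms(1) by (simp add: star_shaped_body_def compact_body_def)
  have V: "0 < vol S"
    using assms(2) unfolding eta_def by (metis divide_eq_0_iff less_irrefl measure_nonneg order_le_less vol_def)
  have far: "vol {x \<in> S. L \<le> norm (x - z)} \<le> \<eta> * vol S * (R / L)\<^sup>2" if "0 < L" for L
  proof -
    have "integral S (\<lambda>x. (norm (x - z))\<^sup>2) = M * vol S"
      using V by (simp add: M_def second_moment_def z_def)
    then show ?thesis
      using vol_far_le[OF S that, of z] R pos by (simp add: power_divide mult.commute)
  qed
  have d: "0 \<le> d"
    unfolding d_def set_dist_def using False by (intro cInf_greatest) auto
  have sep: "d \<le> norm (x - y)" if "x \<in> S1" "y \<in> S2" for x y
    unfolding d_def set_dist_def using that by (intro cInf_lower bdd_belowI[of _ 0]) auto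
  have sep': "d \<le> norm (y - x)" if "y \<in> S2" "x \<in> S1" for x y
    using sep[OF that(2,1)] by (simp add: norm_minus_commute)
  let ?K = "kernel S \<inter> cball z (2 * R)"
  have lm: "T \<in> lmeasurable" if "T \<subseteq> S" "T \<in> sets lebesgue" for T
    using that S by (meson bounded_set_imp_lmeasurable bounded_subset compact_imp_bounded)
  have parts: "S1 \<in> lmeasurable" "S2 \<in> lmeasurable" "S3 \<in> lmeasurable"
    using assms lm by auto
  have K: "?K \<in> lmeasurable"
    using compact_kernel[OF S] by (auto intro!: lmeasurable_compact compact_Int_closed)
  have "vol ?K \<le> vol (S1 \<inter> ?K) + vol ((S2 \<inter> ?K) \<union> S3)"
    using assms(9) parts K by (intro vol_le_add) (auto simp: kernel_def)
  also have "vol ((S2 \<inter> ?K) \<union> S3) \<le> vol (S2 \<inter> ?K) + vol S3"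
    using parts K by (intro vol_le_add) auto
  finally have split: "vol ?K \<le> vol (S1 \<inter> ?K) + (vol (S2 \<inter> ?K) + vol S3)"
    by simp
  have "vol (kernel S) = \<eta> * vol S"
    using V by (simp add: \<eta>_def eta_def)
  then have "3 / 4 * (\<eta> * vol S) \<le> vol ?K"
    using vol_kernel_near_ge[OF S, of z R] far[of "2 * R"] R by (simp add: power_divide)
  moreover have "vol S3 < \<eta> * vol S / 4"
    using False by (simp add: \<eta>_def)
  \<comment> \<open>Of at least three quarters of the kernel's volume, \<open>S3\<close> takes less
    than one; over half remains for \<open>S1\<close> and \<open>S2\<close>, so one of them has at
    least a quarter.\<close>
  ultimately have "\<eta> * vol S / 4 \<le> vol (S1 \<inter> ?K) \<or> \<eta> * vol S / 4 \<le> vol (S2 \<inter> ?K)"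
    using split by linarith
  then have "\<eta> * d / (16 * R) * min (vol S1) (vol S2) \<le> vol S3"
  proof
    assume "\<eta> * vol S / 4 \<le> vol (S1 \<inter> ?K)"
    then show ?thesis
      using assms S R pos far sep d \<eta>_def
      by (intro star_shaped_separation_one_sided[where S = S and z = z]) auto
  next
    assume "\<eta> * vol S / 4 \<le> vol (S2 \<inter> ?K)"
    then have "\<eta> * d / (16 * R) * min (vol S2) (vol S1) \<le> vol S3"
      using assms S R pos far sep' d \<eta>_def
      by (intro star_shaped_separation_one_sided[where S = S and z = z]) auto
    then show ?thesis
      by (simp add: min.commute)
  qed
  moreover have "\<eta> powr (3/2) / (16 * sqrt M) = \<eta> / (16 * R)"
  proof -
    have "\<eta> powr (3/2) = \<eta> powr (1 + 1/2)"
      by simp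
    also have "\<dots> = \<eta> * sqrt \<eta>"
      using pos by (simp only: powr_add powr_half_sqrt) simp
    finally show ?thesis
      using pos by (simp add: R_def real_sqrt_divide)
  qed
  ultimately show ?thesis
    by (simp add: \<eta>_def M_def d_def)
qed

end
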